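(* Let $f:[0,1]\to\mathbb{R}$ be a bounded function and let $(N,k_{\max})$ be an admissible pair with $k_{\max}\ge2$. For $k=1,\dots,k_{\max}$ define $$\widetilde{L}\left(\frac{k}{N-1}\right)=\frac1k\sum_{m=1}^k\frac{k}{N-1}\,C_{N,k,m}V_{N,k,m},$$ and assume that $\widetilde{L}\left(\frac{k}{N-1}\right)>0$ for all $k=1,\dots,k_{\max}$. Let $L$ be the slope of the least-squares regression line through the data points $$\left\{\left(\log\frac{k}{N-1},\ \log\widetilde{L}\left(\frac{k}{N-1}\right)\right) : k=1,\dots,k_{\max}\right\}.$$ Then $2-L=\mathrm{HFD}(f,N,k_{\max})$.
   Context: Higuchi fractal dimension (HFD). A pair $(N,k_{\max})$ of positive integers is called admissible if $N\ge 2$ and $k_{\max}\le\lfloor N/2\rfloor$. Given a bounded function $f:[0,1]\to\mathbb{R}$ and an admissible pair $(N,k_{\max})$, put $X_N(j)=f\left(\frac{j-1}{N-1}\right)$ for $j=1,\dots,N$. For $1\le m\le k\le k_{\max}$ define $$C_{N,k,m}=\frac{N-1}{\lfloor\frac{N-m}{k}\rfloor k},\qquad V_{N,k,m}=\sum_{i=1}^{\lfloor\frac{N-m}{k}\rfloor}|X_N(m+ik)-X_N(m+(i-1)k)|,$$ $$L_m(k)=\frac1k C_{N,k,m}V_{N,k,m},\qquad L(k)=\frac1k\sum_{m=1}^k L_m(k).$$ Let $\mathcal{I}=\{k\in\{1,\dots,k_{\max}\} : L(k)\ne0\}$ and $\mathcal{Z}=\{(\log\frac1k,\log L(k)) : k\in\mathcal{I}\}$.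 If $|\mathcal{I}|\le1$, set $\mathrm{HFD}(f,N,k_{\max})=1$. Otherwise $\mathrm{HFD}(f,N,k_{\max})$ is the slope of the least-squares best fitting affine function through $\mathcal{Z}$. The least-squares slope for data $(x_1,y_1),\dots,(x_n,y_n)$ is $\frac{\sum_i(x_i-\overline{x})(y_i-\overline{y})}{\sum_i(x_i-\overline{x})^2}$ with $\overline{x},\overline{y}$ the arithmetic means. *)

theory Defs
  imports "HOL-Analysis.Analysis"
begin

(* The arithmetic means run over the points of D, so D has to be a finite set in which equal data
   points are not meant to be counted repeatedly; in the data sets below distinct indices k give
   distinct abscissae. *)
definition mean_fst :: "(real \<times> real) set \<Rightarrow> real" where
  "mean_fst D = (\<Sum>p\<in>D. fst p) / real (card D)"

definition mean_snd :: "(real \<times> real) set \<Rightarrow> real" where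
  "mean_snd D = (\<Sum>p\<in>D. snd p) / real (card D)"

definition least_squares_slope :: "(real \<times> real) set \<Rightarrow> real" where
  "least_squares_slope D =
     (\<Sum>p\<in>D. (fst p - mean_fst D) * (snd p - mean_snd D)) / (\<Sum>p\<in>D. (fst p - mean_fst D)\<^sup>2)"

definition admissible :: "nat \<Rightarrow> nat \<Rightarrow> bool" where
  "admissible N kmax \<longleftrightarrow> 2 \<le> N \<and> 1 \<le> kmax \<and> kmax \<le> N div 2"

(* A function on [0,1] is represented by a function on the reals; for 1 \<le> j \<le> N only its
   values on [0,1] are used. *)
definition higuchi_X :: "(real \<Rightarrow> real) \<Rightarrow> nat \<Rightarrow> nat \<Rightarrow> real" where
  "higuchi_X f N j = f ((real j - 1) / (real N - 1))"

(* Below 1 \<le> m \<le> k \<le> N div 2, so that N - m is the true difference and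
   (N - m) div k is the integer part of (N - m) / k, which is positive. *)
definition higuchi_C :: "nat \<Rightarrow> nat \<Rightarrow> nat \<Rightarrow> real" where
  "higuchi_C N k m = (real N - 1) / (real ((N - m) div k) * real k)"

definition higuchi_V :: "(real \<Rightarrow> real) \<Rightarrow> nat \<Rightarrow> nat \<Rightarrow> nat \<Rightarrow> real" where
  "higuchi_V f N k m =
     (\<Sum>i = 1..(N - m) div k. \<bar>higuchi_X f N (m + i * k) - higuchi_X f N (m + (i - 1) * k)\<bar>)"

definition higuchi_Lm :: "(real \<Rightarrow> real) \<Rightarrow> nat \<Rightarrow> nat \<Rightarrow> nat \<Rightarrow> real" where
  "higuchi_Lm f N m k = 1 / real k * higuchi_C N k m * higuchi_V f N k m"

definition higuchi_L :: "(real \<Rightarrow> real) \<Rightarrow> nat \<Rightarrow> nat \<Rightarrow> real" where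
  "higuchi_L f N k = 1 / real k * (\<Sum>m = 1..k. higuchi_Lm f N m k)"

definition higuchi_I :: "(real \<Rightarrow> real) \<Rightarrow> nat \<Rightarrow> nat \<Rightarrow> nat set" where
  "higuchi_I f N kmax = {k \<in> {1..kmax}. higuchi_L f N k \<noteq> 0}"

definition higuchi_Z :: "(real \<Rightarrow> real) \<Rightarrow> nat \<Rightarrow> nat \<Rightarrow> (real \<times> real) set" where
  "higuchi_Z f N kmax = (\<lambda>k. (ln (1 / real k), ln (higuchi_L f N k))) ` higuchi_I f N kmax"

definition HFD :: "(real \<Rightarrow> real) \<Rightarrow> nat \<Rightarrow> nat \<Rightarrow> real" where
  "HFD f N kmax =
     (if card (higuchi_I f N kmax) \<le> 1 then 1 else least_squares_slope (higuchi_Z f N kmax))"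

(* The value of the rescaled curve length at scale k / (N - 1), indexed by k. *)
definition higuchi_L_tilde :: "(real \<Rightarrow> real) \<Rightarrow> nat \<Rightarrow> nat \<Rightarrow> real" where
  "higuchi_L_tilde f N k =
     1 / real k * (\<Sum>m = 1..k. real k / (real N - 1) * higuchi_C N k m * higuchi_V f N k m)"

end

theory Submission
  imports Defs
begin

text \<open>Since \<open>L_tilde(k/(N-1)) = k\<^sup>2 L(k) / (N-1)\<close>, the data set of the theorem is the
  image of the Higuchi data set under the affine map \<open>(x, y) \<mapsto> (-x - c, -2x + y - c)\<close> with
  \<open>c = ln (N-1)\<close>. Under a map \<open>(x, y) \<mapsto> (a x + b, u x + v y + w)\<close> the least-squares slope \<open>s\<close>
  becomes \<open>(u + v s) / a\<close>, here \<open>2 - s\<close>.\<close>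

text \<open>Two points with different abscissae cannot both sit at the mean, so some square is
  positive. This keeps the denominator of the slope away from 0.\<close>

lemma sum_square_deviation_pos:
  assumes "finite D" and "inj_on fst D" and "2 \<le> card D"
  shows "0 < (\<Sum>p\<in>D. (fst p - mean_fst D)\<^sup>2)"
proof -
  obtain p q where pq: "p \<in> D" "q \<in> D" "p \<noteq> q"
    using assms(1,3) card_le_Suc0_iff_eq[of D] by fastforce
  then have "fst p \<noteq> fst q"
    using assms(2) by (auto dest: inj_onD)
  then obtain r where "r \<in> D" "fst r \<noteq> mean_fst D"
    using pq by metis
  then show ?thesis
    using assms(1) by (intro sum_pos2[of D r]) auto
qed

text \<open>The means move along with the points, so \<open>b\<close> and \<open>w\<close> drop out
  of all deviations. The shear term with coefficient \<open>u\<close> feeds a multiple of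
  \<open>Sxx\<close> into the new mixed sum.\<close>

lemma least_squares_slope_affine:
  fixes D :: "(real \<times> real) set" and a b u v w :: real
  assumes fin: "finite D" and inj: "inj_on fst D" and card: "2 \<le> card D" and a: "a \<noteq> 0"
  defines "T \<equiv> \<lambda>p :: real \<times> real. (a * fst p + b, u * fst p + v * snd p + w)"
  shows "least_squares_slope (T ` D) = (u + v * least_squares_slope D) / a"
proof -
  \<comment> \<open>As \<open>a\<close> is nonzero, first coordinates stay distinct: no points
    merge, and sums over the image can be reindexed.\<close>
  have injT: "inj_on T D"
    using inj a by (auto simp: T_def inj_on_def)
  have card0: "real (card D) \<noteq> 0"
    using card by simp
  have mean1: "mean_fst (T ` D) = a * mean_fst D + b"
    using card0 unfolding mean_fst_def sum.reindex[OF injT] card_image[OF injT]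
    by (simp add: T_def sum.distrib sum_distrib_left[symmetric] field_simps)
  have mean2: "mean_snd (T ` D) = u * mean_fst D + v * mean_snd D + w"
    using card0 unfolding mean_snd_def mean_fst_def sum.reindex[OF injT] card_image[OF injT]
    by (simp add: T_def sum.distrib sum_distrib_left[symmetric] field_simps)
  define Sxx where "Sxx = (\<Sum>p\<in>D. (fst p - mean_fst D)\<^sup>2)"
  define Sxy where "Sxy = (\<Sum>p\<in>D. (fst p - mean_fst D) * (snd p - mean_snd D))"
  have "Sxx > 0"
    unfolding Sxx_def using fin inj card by (rule sum_square_deviation_pos)
  have Txx: "(\<Sum>p\<in>T ` D. (fst p - mean_fst (T ` D))\<^sup>2) = a\<^sup>2 * Sxx"
    unfolding mean1 sum.reindex[OF injT] Sxx_def sum_distrib_left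
    by (intro sum.cong) (auto simp: T_def power2_eq_square algebra_simps)
  have Txy: "(\<Sum>p\<in>T ` D. (fst p - mean_fst (T ` D)) * (snd p - mean_snd (T ` D)))
      = a * (u * Sxx + v * Sxy)"
    unfolding mean1 mean2 sum.reindex[OF injT] Sxx_def Sxy_def sum_distrib_left
      sum.distrib[symmetric]
    by (intro sum.cong) (auto simp: T_def power2_eq_square algebra_simps)
  show ?thesis
    using a \<open>Sxx > 0\<close>
    unfolding least_squares_slope_def Txx Txy Sxx_def[symmetric] Sxy_def[symmetric]
    by (simp add: power2_eq_square field_simps)
qed

lemma higuchi_L_tilde_eq:
  assumes "k \<noteq> 0"
  shows "higuchi_L_tilde f N k = (real k)\<^sup>2 / (real N - 1) * higuchi_L f N k"
  using assms
  by (simp add: higuchi_L_tilde_def higuchi_L_def higuchi_Lm_def sum_distrib_left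
      sum_divide_distrib power2_eq_square mult.assoc)

theorem theorem4p2:
  fixes f :: "real \<Rightarrow> real" and N kmax :: nat
  assumes "bounded (f ` {0..1})"
    and "admissible N kmax"
    and "2 \<le> kmax"
    and "\<forall>k\<in>{1..kmax}. higuchi_L_tilde f N k > 0"
  shows "2 - least_squares_slope
               ((\<lambda>k. (ln (real k / (real N - 1)), ln (higuchi_L_tilde f N k))) ` {1..kmax})
         = HFD f N kmax"
proof -
  define c where "c = ln (real N - 1)"
  define z where "z k = (ln (1 / real k), ln (higuchi_L f N k))" for k
  \<comment> \<open>The coefficients -1 and 1 are spelled out to match the shape of the map in
    \<open>least_squares_slope_affine\<close>.\<close>
  define T where "T p = (- 1 * fst p + (- c), - 2 * fst p + 1 * snd p + (- c))"
    for p :: "real \<times> real"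
  have N: "real N - 1 > 0"
    using assms(2) by (simp add: admissible_def)
  have L_pos: "higuchi_L f N k > 0" if "k \<in> {1..kmax}" for k
    using assms(4) that N by (auto simp: higuchi_L_tilde_eq zero_less_mult_iff zero_less_divide_iff)
  then have I: "higuchi_I f N kmax = {1..kmax}"
    by (force simp: higuchi_I_def)
  have Z: "higuchi_Z f N kmax = z ` {1..kmax}"
    by (simp add: higuchi_Z_def I z_def)
  \<comment> \<open>Distinct scales have distinct logarithms, so the data set really has
    \<open>kmax\<close> points.\<close>
  have inj_fst_z: "inj_on (fst \<circ> z) {1..kmax}"
    by (auto simp: inj_on_def z_def ln_div)
  have "card (z ` {1..kmax}) = kmax"
    using inj_fst_z by (simp add: card_image inj_on_imageI2)
  moreover have "inj_on fst (z ` {1..kmax})"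
    using inj_fst_z by (rule inj_on_imageI)
  ultimately have "least_squares_slope (T ` z ` {1..kmax})
      = (- 2 + 1 * least_squares_slope (z ` {1..kmax})) / (- 1)"
    unfolding T_def using assms(3) by (intro least_squares_slope_affine) auto
  \<comment> \<open>All factors are positive, so the logarithms split; the square of
    \<open>k\<close> contributes \<open>2 * ln (real k)\<close>, which is -2 times the abscissa of
    \<open>z k\<close>.\<close>
  moreover have "(ln (real k / (real N - 1)), ln (higuchi_L_tilde f N k)) = T (z k)"
    if "k \<in> {1..kmax}" for k
    using that N L_pos[OF that]
    by (simp add: T_def z_def c_def higuchi_L_tilde_eq ln_mult ln_div ln_realpow)
  then have "(\<lambda>k. (ln (real k / (real N - 1)), ln (higuchi_L_tilde f N k))) ` {1..kmax}
      = T ` z ` {1..kmax}"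
    unfolding image_image by (intro image_cong) auto
  \<comment> \<open>With at least two indices in \<open>higuchi_I\<close>, the default value 1 is
    excluded.\<close>
  moreover have "HFD f N kmax = least_squares_slope (z ` {1..kmax})"
    using assms(3) by (simp add: HFD_def I Z)
  ultimately show ?thesis
    by simp
qed

end
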